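(* For every real $x$ with $0 < x < 1$, $$\left(\frac{\arcsin x}{x}\right)^{2} + \frac{\arctan x}{x} < 2 + \frac{\pi^2+\pi-8}{\pi}\, x^3 \arctan x,$$ and the constant $\frac{\pi^2+\pi-8}{\pi}$ is the best possible, i.e. it is the smallest real number $c$ such that $\left(\frac{\arcsin x}{x}\right)^{2} + \frac{\arctan x}{x} < 2 + c\, x^3 \arctan x$ holds for all $x \in (0,1)$.
   Context: Here $\arcsin$ and $\arctan$ are the usual real principal inverse trigonometric functions. *)

theory Defs
  imports Complex_Main
begin

end

theory Submission
  imports Defs "HOL-Analysis.Complex_Transcendental"
begin

text \<open>
  Let \<open>K = pi\<^sup>2 / 4 + pi / 4 - 2\<close>, so that the constant is \<open>4 * K / pi\<close> and equality holds at
  \<open>x = 1\<close>; letting \<open>x\<close> tend to 1 from below shows that no smaller constant works. By concavity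
  \<open>arctan x \<ge> pi / 4 * x\<close>, so it suffices that \<open>(arcsin x)\<^sup>2 + x * arctan x < 2 * x\<^sup>2 + K * x ^ 6\<close>.
  Truncate the power series of \<open>(arcsin x)\<^sup>2\<close> and of \<open>x * arctan x\<close> after the term in \<open>x ^ 6\<close>, and
  add a term in \<open>x ^ 8\<close> chosen to give equality at \<open>x = 1\<close>. Both resulting polynomials are upper
  bounds on \<open>[0, 1]\<close>, because the differences vanish at 0 and 1 and first increase, then decrease.
  The sum of the two bounds is \<open>2 * x\<^sup>2 + 17 / 45 * x ^ 6 + (K - 17 / 45) * x ^ 8\<close>,
  and \<open>K > 17 / 45\<close>.
\<close>

text \<open>Once negative, \<open>f'\<close> stays negative. So if \<open>f' x < 0\<close>, then
  \<open>f\<close> decreases from \<open>x\<close> to \<open>b\<close> and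
  \<open>f x \<ge> f b\<close>; otherwise \<open>f' \<ge> 0\<close> on all of \<open>(a, x)\<close>
  and \<open>f x \<ge> f a\<close>.\<close>

lemma nonneg_if_deriv_changes_sign_once:
  fixes f f' :: "real \<Rightarrow> real"
  assumes cont: "continuous_on {a..b} f"
    and deriv: "\<And>x. a < x \<Longrightarrow> x < b \<Longrightarrow> (f has_real_derivative f' x) (at x)"
    and sign: "\<And>x y. a < x \<Longrightarrow> x < y \<Longrightarrow> y < b \<Longrightarrow> f' x < 0 \<Longrightarrow> f' y < 0"
    and "0 \<le> f a" "0 \<le> f b" "a \<le> x" "x \<le> b"
  shows "0 \<le> f x"
proof (cases "x = a \<or> x = b")
  case True
  then show ?thesis using assms by auto
next
  case False
  then have x: "a < x" "x < b" using assms by auto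
  show ?thesis
  proof (cases "f' x < 0")
    case True
    have "f b \<le> f x"
    proof (rule DERIV_nonpos_imp_decreasing_open[of x b f])
      fix y assume "x < y" "y < b"
      then show "\<exists>d. (f has_real_derivative d) (at y) \<and> d \<le> 0"
        using deriv[of y] sign[of x y] x True by (intro exI[of _ "f' y"]) auto
    qed (use x in \<open>auto intro: continuous_on_subset[OF cont]\<close>)
    then show ?thesis using \<open>0 \<le> f b\<close> by simp
  next
    case False
    have "f a \<le> f x"
    proof (rule DERIV_nonneg_imp_increasing_open[of a x f])
      fix y assume "a < y" "y < x"
      then show "\<exists>d. (f has_real_derivative d) (at y) \<and> 0 \<le> d"
        using deriv[of y] sign[of y x] x False by (intro exI[of _ "f' y"]) force
    qed (use x in \<open>auto intro: continuous_on_subset[OF cont]\<close>)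
    then show ?thesis using \<open>0 \<le> f a\<close> by simp
  qed
qed

lemma arctan_ge_chord:
  fixes x :: real
  assumes "0 \<le> x" "x \<le> 1"
  shows "pi / 4 * x \<le> arctan x"
proof -
  have "0 \<le> arctan x - pi / 4 * x"
  proof (rule nonneg_if_deriv_changes_sign_once[where a = 0 and b = 1
        and f = "\<lambda>x. arctan x - pi / 4 * x"
        and f' = "\<lambda>x. 1 / (1 + x\<^sup>2) - pi / 4"])
    show "((\<lambda>x. arctan x - pi / 4 * x) has_real_derivative 1 / (1 + x\<^sup>2) - pi / 4) (at x)" for x
      by (auto intro!: derivative_eq_intros simp: inverse_eq_divide)
    fix x y :: real assume "0 < x" "x < y" "1 / (1 + x\<^sup>2) - pi / 4 < 0"
    moreover from this have "1 / (1 + y\<^sup>2) \<le> 1 / (1 + x\<^sup>2)"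
      by (intro divide_left_mono add_left_mono power_mono mult_pos_pos add_pos_nonneg) auto
    ultimately show "1 / (1 + y\<^sup>2) - pi / 4 < 0" by simp
  qed (use assms in \<open>auto intro!: continuous_intros simp: arctan_one\<close>)
  then show ?thesis by simp
qed

text \<open>As \<open>13 / 15 = 1 - 1 / 3 + 1 / 5\<close>, both sides agree at 1. Since
  \<open>(1 - x^2 + x^4) * (1 + x^2) = 1 + x^6\<close>, the derivative of the difference has the
  sign of \<open>1 - 7 * g * (1 + x^2)\<close>, where \<open>g = 13 / 15 - pi / 4\<close>.\<close>

lemma arctan_le_poly:
  fixes x :: real
  assumes "0 \<le> x" "x \<le> 1"
  shows "arctan x \<le> x - x ^ 3 / 3 + x ^ 5 / 5 - (13 / 15 - pi / 4) * x ^ 7"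
proof -
  define g where "g = 13 / 15 - pi / 4"
  have "0 \<le> x - x ^ 3 / 3 + x ^ 5 / 5 - g * x ^ 7 - arctan x"
  proof (rule nonneg_if_deriv_changes_sign_once[where a = 0 and b = 1
        and f = "\<lambda>x. x - x ^ 3 / 3 + x ^ 5 / 5 - g * x ^ 7 - arctan x"
        and f' = "\<lambda>x. x ^ 6 * (1 - 7 * g * (1 + x\<^sup>2)) / (1 + x\<^sup>2)"])
    fix x :: real
    have nz: "1 + x\<^sup>2 \<noteq> 0" by (smt (verit) zero_le_power2)
    have "1 - x\<^sup>2 + x ^ 4 - 7 * g * x ^ 6 - 1 / (1 + x\<^sup>2)
        = x ^ 6 * (1 - 7 * g * (1 + x\<^sup>2)) / (1 + x\<^sup>2)"
      using nz by (simp add: field_simps)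
    moreover have "((\<lambda>x. x - x ^ 3 / 3 + x ^ 5 / 5 - g * x ^ 7 - arctan x) has_real_derivative
        1 - x\<^sup>2 + x ^ 4 - 7 * g * x ^ 6 - 1 / (1 + x\<^sup>2)) (at x)"
      by (auto intro!: derivative_eq_intros simp: inverse_eq_divide)
    ultimately show "((\<lambda>x. x - x ^ 3 / 3 + x ^ 5 / 5 - g * x ^ 7 - arctan x) has_real_derivative
        x ^ 6 * (1 - 7 * g * (1 + x\<^sup>2)) / (1 + x\<^sup>2)) (at x)" by simp
  next
    fix x y :: real
    assume xy: "0 < x" "x < y" and neg: "x ^ 6 * (1 - 7 * g * (1 + x\<^sup>2)) / (1 + x\<^sup>2) < 0"
    have pos: "0 < 1 + x\<^sup>2" "0 < 1 + y\<^sup>2" by (auto intro: add_pos_nonneg)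
    with neg xy have *: "1 < 7 * g * (1 + x\<^sup>2)"
      by (auto simp: divide_less_0_iff mult_less_0_iff)
    \<comment> \<open>Negativity of the derivative at \<open>x\<close> itself forces
      \<open>g > 0\<close>, so the factor \<open>1 - 7 * g * (1 + x^2)\<close> only decreases
      further.\<close>
    then have "0 < g" using pos by (smt (verit) mult_nonpos_nonneg)
    then have "7 * g * (1 + x\<^sup>2) \<le> 7 * g * (1 + y\<^sup>2)"
      using xy by (intro mult_left_mono add_left_mono power_mono) auto
    with * xy pos show "y ^ 6 * (1 - 7 * g * (1 + y\<^sup>2)) / (1 + y\<^sup>2) < 0"
      by (auto simp: divide_less_0_iff mult_less_0_iff)
  qed (use assms in \<open>auto intro!: continuous_intros simp: arctan_one g_def\<close>)
  then show ?thesis by (simp add: g_def)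
qed

text \<open>Equality at 1 comes from \<open>68 / 45 = 1 + 1 / 3 + 8 / 45\<close>. The sign argument
  is nested: \<open>w'\<close> passes from nonnegative to negative at most once and
  \<open>w 0 = 0\<close>, so the same holds for \<open>w\<close>, which has the sign of the
  derivative of the difference.\<close>

lemma arcsin_squared_le_poly:
  fixes x :: real
  assumes "0 \<le> x" "x \<le> 1"
  shows "(arcsin x)\<^sup>2 \<le> x\<^sup>2 + x ^ 4 / 3 + 8 / 45 * x ^ 6 + (pi\<^sup>2 / 4 - 68 / 45) * x ^ 8"
proof -
  define b where "b = pi\<^sup>2 / 4 - 68 / 45"
  have "3\<^sup>2 \<le> pi\<^sup>2" using pi_gt3 by (intro power_mono) auto
  then have b: "1 / 2 < b" by (simp add: b_def)
  define p' where "p' = (\<lambda>x::real. 2 * x + 4 / 3 * x ^ 3 + 16 / 15 * x ^ 5 + 8 * b * x ^ 7)"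
  \<comment> \<open>\<open>y = (arcsin x)\<^sup>2\<close> satisfies \<open>(1 - x\<^sup>2) * y'' - x * y' = 2\<close>, so multiplying the derivative of
    the difference by \<open>sqrt (1 - x\<^sup>2)\<close> gives a function whose derivative is elementary.\<close>
  define w where "w = (\<lambda>x. sqrt (1 - x\<^sup>2) * p' x - 2 * arcsin x)"
  define w' where "w' = (\<lambda>x. x ^ 6 * (56 * b - 32 / 5 - 64 * b * x\<^sup>2) / sqrt (1 - x\<^sup>2))"
  have sq: "0 < 1 - x\<^sup>2" if "0 \<le> x" "x < 1" for x :: real
    using that by (simp add: power_less_one_iff abs_square_less_1)
  have w_deriv: "(w has_real_derivative w' x) (at x)" if x: "0 \<le> x" "x < 1" for x
  proof -
    let ?s = "sqrt (1 - x\<^sup>2)"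
    have s: "0 < ?s" "?s * ?s = 1 - x\<^sup>2" using sq[OF x] by auto
    have ss: "?s * (?s * z) = (1 - x\<^sup>2) * z" for z
      using s(2) by (metis mult.assoc)
    have "(w has_real_derivative
        (- x / ?s * p' x + ?s * (2 + 4 * x\<^sup>2 + 16 / 3 * x ^ 4 + 56 * b * x ^ 6) - 2 / ?s)) (at x)"
      unfolding w_def p'_def using sq[OF x] x
      by (auto intro!: derivative_eq_intros simp: divide_simps ss)
    moreover have "- x / ?s * p' x + ?s * (2 + 4 * x\<^sup>2 + 16 / 3 * x ^ 4 + 56 * b * x ^ 6) - 2 / ?s
        = (- x * p' x + (?s * ?s) * (2 + 4 * x\<^sup>2 + 16 / 3 * x ^ 4 + 56 * b * x ^ 6) - 2) / ?s"
      using s(1) by (simp add: field_simps del: real_sqrt_mult_self)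
    moreover have "- x * p' x + (1 - x\<^sup>2) * (2 + 4 * x\<^sup>2 + 16 / 3 * x ^ 4 + 56 * b * x ^ 6) - 2
        = x ^ 6 * (56 * b - 32 / 5 - 64 * b * x\<^sup>2)"
      by (simp add: p'_def field_simps eval_nat_numeral)
    ultimately show ?thesis unfolding w'_def s(2) by simp
  qed
  have w'_sign: "w' y < 0" if "0 < x" "x < y" "y < 1" "w' x < 0" for x y
  proof -
    have "64 * b * x\<^sup>2 \<le> 64 * b * y\<^sup>2"
      using that b by (intro mult_left_mono power_mono) auto
    then show ?thesis
      using that sq[of x] sq[of y] by (auto simp: w'_def divide_less_0_iff mult_less_0_iff)
  qed
  have w_sign: "w y < 0" if x: "0 < x" "x < y" "y < 1" "w x < 0" for x y
  proof -
    have w0: "w 0 = 0" by (simp add: w_def p'_def)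
    \<comment> \<open>Since \<open>w x < 0 = w 0\<close>, \<open>w'\<close> is negative at some
      \<open>z < x\<close>, hence on all of \<open>[z, 1)\<close>, and \<open>w\<close> keeps
      falling beyond \<open>x\<close>.\<close>
    obtain z where z: "0 < z" "z < x" "w x - w 0 = (x - 0) * w' z"
      using MVT2[of 0 x w w'] x w_deriv by force
    then have "w' z < 0" using x w0 by (auto simp: mult_less_0_iff)
    then have "w y < w x"
      using x z w_deriv w'_sign[of z] by (intro DERIV_neg_imp_decreasing[of x y w]) force+
    then show ?thesis using x by simp
  qed
  have "0 \<le> x\<^sup>2 + x ^ 4 / 3 + 8 / 45 * x ^ 6 + b * x ^ 8 - (arcsin x)\<^sup>2"
  proof (rule nonneg_if_deriv_changes_sign_once[where a = 0 and b = 1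
        and f = "\<lambda>x. x\<^sup>2 + x ^ 4 / 3 + 8 / 45 * x ^ 6 + b * x ^ 8 - (arcsin x)\<^sup>2"
        and f' = "\<lambda>x. w x / sqrt (1 - x\<^sup>2)"])
    fix x :: real assume x: "0 < x" "x < 1"
    have "((\<lambda>x. x\<^sup>2 + x ^ 4 / 3 + 8 / 45 * x ^ 6 + b * x ^ 8 - (arcsin x)\<^sup>2)
        has_real_derivative p' x - 2 * arcsin x / sqrt (1 - x\<^sup>2)) (at x)"
      unfolding p'_def using sq[of x] x
      by (auto intro!: derivative_eq_intros simp: divide_simps)
    moreover have "p' x - 2 * arcsin x / sqrt (1 - x\<^sup>2) = w x / sqrt (1 - x\<^sup>2)"
      using sq[of x] x by (simp add: w_def diff_divide_distrib)
    ultimately show "((\<lambda>x. x\<^sup>2 + x ^ 4 / 3 + 8 / 45 * x ^ 6 + b * x ^ 8 - (arcsin x)\<^sup>2)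
        has_real_derivative w x / sqrt (1 - x\<^sup>2)) (at x)" by simp
  next
    fix x y :: real assume "0 < x" "x < y" "y < 1" "w x / sqrt (1 - x\<^sup>2) < 0"
    then show "w y / sqrt (1 - y\<^sup>2) < 0"
      using sq[of x] sq[of y] w_sign[of x y] by (auto simp: divide_less_0_iff)
  qed (use assms in \<open>auto intro!: continuous_intros simp: b_def power_divide\<close>)
  then show ?thesis by (simp add: b_def)
qed

lemma arcsin_arctan_poly_bound:
  fixes x :: real
  assumes "0 < x" "x < 1"
  shows "(arcsin x)\<^sup>2 + x * arctan x < 2 * x\<^sup>2 + (pi\<^sup>2 / 4 + pi / 4 - 2) * x ^ 6"
proof -
  \<comment> \<open>\<open>d\<close> is the total coefficient of \<open>x ^ 8\<close>. The
    \<open>x ^ 4\<close> terms cancel, the \<open>x ^ 6\<close> terms give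
    \<open>8 / 45 + 1 / 5 = 17 / 45\<close>, and \<open>d > 0\<close> allows \<open>x ^ 8\<close> to
    be replaced by \<open>x ^ 6\<close>.\<close>
  define d where "d = pi\<^sup>2 / 4 + pi / 4 - 107 / 45"
  have "3\<^sup>2 \<le> pi\<^sup>2" using pi_gt3 by (intro power_mono) auto
  then have d: "0 < d" using pi_gt3 by (simp add: d_def)
  have "x * arctan x \<le> x * (x - x ^ 3 / 3 + x ^ 5 / 5 - (13 / 15 - pi / 4) * x ^ 7)"
    using assms by (intro mult_left_mono arctan_le_poly) auto
  then have "(arcsin x)\<^sup>2 + x * arctan x \<le>
      x\<^sup>2 + x ^ 4 / 3 + 8 / 45 * x ^ 6 + (pi\<^sup>2 / 4 - 68 / 45) * x ^ 8
      + x * (x - x ^ 3 / 3 + x ^ 5 / 5 - (13 / 15 - pi / 4) * x ^ 7)"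
    using arcsin_squared_le_poly[of x] assms by linarith
  also have "\<dots> = 2 * x\<^sup>2 + 17 / 45 * x ^ 6 + d * x ^ 8"
    by (simp add: d_def algebra_simps eval_nat_numeral)
  also have "\<dots> < 2 * x\<^sup>2 + 17 / 45 * x ^ 6 + d * x ^ 6"
    using assms d by (simp add: power_strict_decreasing)
  also have "\<dots> = 2 * x\<^sup>2 + (pi\<^sup>2 / 4 + pi / 4 - 2) * x ^ 6"
    by (simp add: d_def algebra_simps)
  finally show ?thesis .
qed

theorem mainTheorem1:
  shows "(\<forall>x::real. 0 < x \<and> x < 1 \<longrightarrow>
            (arcsin x / x)\<^sup>2 + arctan x / x
              < 2 + (pi\<^sup>2 + pi - 8) / pi * x ^ 3 * arctan x)
       \<and> (\<forall>c::real.
            (\<forall>x::real. 0 < x \<and> x < 1 \<longrightarrow>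
               (arcsin x / x)\<^sup>2 + arctan x / x < 2 + c * x ^ 3 * arctan x)
            \<longrightarrow> (pi\<^sup>2 + pi - 8) / pi \<le> c)"
proof (intro conjI allI impI)
  fix x :: real assume x: "0 < x \<and> x < 1"
  define c where "c = (pi\<^sup>2 + pi - 8) / pi"
  have "3\<^sup>2 \<le> pi\<^sup>2" using pi_gt3 by (intro power_mono) auto
  then have c: "0 < c" using pi_gt3 by (simp add: c_def)
  have "(arcsin x)\<^sup>2 + x * arctan x < 2 * x\<^sup>2 + (pi\<^sup>2 / 4 + pi / 4 - 2) * x ^ 6"
    using x by (intro arcsin_arctan_poly_bound) auto
  \<comment> \<open>One factor \<open>x\<close> is split off so that the chord bound turns
    \<open>pi / 4 * x\<close> into \<open>arctan x\<close>.\<close>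
  also have "(pi\<^sup>2 / 4 + pi / 4 - 2) * x ^ 6 = c * x ^ 5 * (pi / 4 * x)"
    by (simp add: c_def field_simps eval_nat_numeral)
  also have "2 * x\<^sup>2 + c * x ^ 5 * (pi / 4 * x) \<le> 2 * x\<^sup>2 + c * x ^ 5 * arctan x"
    using x c by (intro add_left_mono mult_left_mono arctan_ge_chord) auto
  finally have "((arcsin x)\<^sup>2 + x * arctan x) / x\<^sup>2 < (2 * x\<^sup>2 + c * x ^ 5 * arctan x) / x\<^sup>2"
    using x by (intro divide_strict_right_mono) auto
  also have "((arcsin x)\<^sup>2 + x * arctan x) / x\<^sup>2 = (arcsin x / x)\<^sup>2 + arctan x / x"
    using x by (simp add: power_divide add_divide_distrib power2_eq_square)
  also have "(2 * x\<^sup>2 + c * x ^ 5 * arctan x) / x\<^sup>2 = 2 + c * x ^ 3 * arctan x"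
    using x by (simp add: field_simps eval_nat_numeral)
  finally show "(arcsin x / x)\<^sup>2 + arctan x / x < 2 + (pi\<^sup>2 + pi - 8) / pi * x ^ 3 * arctan x"
    by (simp add: c_def)
next
  fix c :: real
  assume *: "\<forall>x::real. 0 < x \<and> x < 1 \<longrightarrow>
      (arcsin x / x)\<^sup>2 + arctan x / x < 2 + c * x ^ 3 * arctan x"
  \<comment> \<open>The limit at 1 from the left reads
    \<open>pi^2 / 4 + pi / 4 \<le> 2 + c * pi / 4\<close>, which is the claimed bound on
    \<open>c\<close>.\<close>
  have "((arcsin 1 / 1)\<^sup>2 + arctan 1 / 1 :: real) \<le> 2 + c * 1 ^ 3 * arctan 1"
  proof (rule tendsto_le)
    have "(arcsin \<longlongrightarrow> arcsin 1) (at_left (1::real))"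
      using continuous_on_arcsin'[unfolded continuous_on_def, THEN bspec, of 1]
      by (simp add: at_within_Icc_at_left)
    then show "((\<lambda>x. (arcsin x / x)\<^sup>2 + arctan x / x) \<longlongrightarrow>
        ((arcsin 1 / 1)\<^sup>2 + arctan 1 / 1 :: real)) (at_left 1)"
      by (intro tendsto_intros) auto
    show "((\<lambda>x. 2 + c * x ^ 3 * arctan x) \<longlongrightarrow> 2 + c * 1 ^ 3 * arctan 1) (at_left 1)"
      by (intro tendsto_intros)
    show "\<forall>\<^sub>F x in at_left 1. (arcsin x / x)\<^sup>2 + arctan x / x \<le> 2 + c * x ^ 3 * arctan x"
      using eventually_at_left_real[of 0 "1::real"] * by (auto elim!: eventually_mono intro: less_imp_le)
  qed simp
  then show "(pi\<^sup>2 + pi - 8) / pi \<le> c"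
    by (simp add: arctan_one power_divide field_simps)
qed

end
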